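(* Let $G$ be a topological group and let $X$ be a binary $G$-space. For $g\in G$ and $x\in X$ let $g_x:X\to X$ be the map $g_x(y)=g(x,y)$. Then the following statements are equivalent: 1. The binary action of $G$ on $X$ is distributive. 2. The map $g_x:X\to X$ is a biequivariant homeomorphism for all $g\in G$ and $x\in X$. 3. For all $g,h\in G$ and $x,y\in X$, the equality $g_x\circ h_y=h_{g_x(y)}\circ g_x$ holds.
   Context: Let $G$ be a topological group with identity $e$ and $X$ a topological space. A binary action of $G$ on $X$ is a continuous map $\alpha:G\times X^2\to X$, written $g(x,y)=\alpha(g,x,y)$, such that $gh(x,y)=g(x,h(x,y))$ and $e(x,y)=y$ for all $g,h\in G$ and $x,y\in X$ (here $gh(x,y)$ means $(gh)(x,y)$). A space $X$ with a fixed binary action of $G$ is called a binary $G$-space. The binary action (and the binary $G$-space) is called distributive if $g(x,h(y,z))=h(g(x,y),g(x,z))$ for all $x,y,z\in X$ and $g,h\in G$. A continuous map $f:X\to Y$ between binary $G$-spaces is called biequivariant if $f(g(x,y))=g(f(x),f(y))$ for all $g\in G$ and $x,y\in X$. *)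

theory Defs
  imports "HOL-Algebra.Group" "HOL-Analysis.Product_Topology"
begin

text \<open>
  Groups and spaces are carrier-based: the points of a space \<open>X\<close> are the elements of
  \<^term>\<open>topspace X\<close>, which may be empty, and no separation axiom is assumed.
\<close>

locale topological_group = group G for G (structure) +
  fixes T
  assumes topspace_eq_carrier: "topspace T = carrier G"
    and continuous_mult: "continuous_map (prod_topology T T) T (\<lambda>(g, h). g \<otimes> h)"
    and continuous_inv: "continuous_map T T (\<lambda>g. inv g)"

text \<open>
  The action is curried: \<open>\<alpha> g x y\<close> is $g(x,y)$, so the partial application \<open>\<alpha> g x\<close> is the
  map $g_x$.
\<close>

locale binary_G_space = topological_group G T for G (structure) and T +
  fixes X :: "'x topology" and \<alpha> :: "'a \<Rightarrow> 'x \<Rightarrow> 'x \<Rightarrow> 'x"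
  assumes continuous_action:
      "continuous_map (prod_topology T (prod_topology X X)) X (\<lambda>(g, x, y). \<alpha> g x y)"
    and action_mult:
      "\<lbrakk>g \<in> carrier G; h \<in> carrier G; x \<in> topspace X; y \<in> topspace X\<rbrakk>
        \<Longrightarrow> \<alpha> (g \<otimes> h) x y = \<alpha> g x (\<alpha> h x y)"
    and action_one:
      "\<lbrakk>x \<in> topspace X; y \<in> topspace X\<rbrakk> \<Longrightarrow> \<alpha> \<one> x y = y"

definition distributive_action ::
    "('g, 'm) monoid_scheme \<Rightarrow> 'x topology \<Rightarrow> ('g \<Rightarrow> 'x \<Rightarrow> 'x \<Rightarrow> 'x) \<Rightarrow> bool" where
  "distributive_action G X \<alpha> \<longleftrightarrow>
    (\<forall>x\<in>topspace X. \<forall>y\<in>topspace X. \<forall>z\<in>topspace X. \<forall>g\<in>carrier G. \<forall>h\<in>carrier G.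
      \<alpha> g x (\<alpha> h y z) = \<alpha> h (\<alpha> g x y) (\<alpha> g x z))"

definition biequivariant ::
    "('g, 'm) monoid_scheme \<Rightarrow> 'x topology \<Rightarrow> ('g \<Rightarrow> 'x \<Rightarrow> 'x \<Rightarrow> 'x)
      \<Rightarrow> 'y topology \<Rightarrow> ('g \<Rightarrow> 'y \<Rightarrow> 'y \<Rightarrow> 'y) \<Rightarrow> ('x \<Rightarrow> 'y) \<Rightarrow> bool" where
  "biequivariant G X \<alpha> Y \<beta> f \<longleftrightarrow>
    continuous_map X Y f \<and>
    (\<forall>g\<in>carrier G. \<forall>x\<in>topspace X. \<forall>y\<in>topspace X. f (\<alpha> g x y) = \<beta> g (f x) (f y))"

end

theory Submission
  imports Defs
begin

text \<open>
  Distributivity, biequivariance of all the maps $g_x$ and the commutation rule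
  $g_x \circ h_y = h_{g_x(y)} \circ g_x$ are one and the same identity: $g(x, h(y,z))$ is
  $g_x(h_y(z))$, and $h(g(x,y), g(x,z))$ is both the value of $h$ on the pair of images under
  $g_x$ and $h_{g_x(y)}(g_x(z))$. So the only content is that each $g_x$ is a homeomorphism, and
  this holds for every binary action (lemma \<open>homeomorphic_map_action\<close>): for fixed $x$ the maps
  $g_x$ form an ordinary continuous action of the group, so $(g^{-1})_x$ is a continuous inverse
  of $g_x$.
\<close>

context binary_G_space
begin

lemma continuous_map_action:
  assumes "g \<in> carrier G" "x \<in> topspace X"
  shows "continuous_map X X (\<alpha> g x)"
proof -
  have "continuous_map X (prod_topology T (prod_topology X X)) (\<lambda>y. (g, x, y))"
    using assms by (simp add: continuous_map_pairedI topspace_eq_carrier)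
  from continuous_map_compose[OF this continuous_action]
  show ?thesis
    by (simp add: o_def)
qed

lemma action_inv_cancel:
  assumes "g \<in> carrier G" "x \<in> topspace X" "y \<in> topspace X"
  shows "\<alpha> (inv g) x (\<alpha> g x y) = y" and "\<alpha> g x (\<alpha> (inv g) x y) = y"
  using assms by (simp_all flip: action_mult add: action_one)

lemma homeomorphic_map_action:
  assumes "g \<in> carrier G" "x \<in> topspace X"
  shows "homeomorphic_map X X (\<alpha> g x)"
proof -
  have "homeomorphic_maps X X (\<alpha> g x) (\<alpha> (inv g) x)"
    using assms by (simp add: homeomorphic_maps_def continuous_map_action action_inv_cancel)
  then show ?thesis
    by (auto simp: homeomorphic_map_maps)
qed

lemma distributive_action_iff_biequivariant:
  "distributive_action G X \<alpha> \<longleftrightarrow>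
    (\<forall>g\<in>carrier G. \<forall>x\<in>topspace X. biequivariant G X \<alpha> X \<alpha> (\<alpha> g x))"
  unfolding distributive_action_def biequivariant_def
  using continuous_map_action by blast

end

theorem theorem3p5:
  fixes G :: "('g, 'm) monoid_scheme" and T :: "'g topology"
    and X :: "'x topology" and \<alpha> :: "'g \<Rightarrow> 'x \<Rightarrow> 'x \<Rightarrow> 'x"
  assumes "binary_G_space G T X \<alpha>"
  shows "(distributive_action G X \<alpha> \<longleftrightarrow>
      (\<forall>g\<in>carrier G. \<forall>x\<in>topspace X.
        homeomorphic_map X X (\<alpha> g x) \<and> biequivariant G X \<alpha> X \<alpha> (\<alpha> g x)))
    \<and> (distributive_action G X \<alpha> \<longleftrightarrow>
      (\<forall>g\<in>carrier G. \<forall>h\<in>carrier G. \<forall>x\<in>topspace X. \<forall>y\<in>topspace X.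
        \<forall>z\<in>topspace X. (\<alpha> g x \<circ> \<alpha> h y) z = (\<alpha> h (\<alpha> g x y) \<circ> \<alpha> g x) z))"
proof -
  interpret binary_G_space G T X \<alpha>
    by (fact assms)
  show ?thesis
  proof (intro conjI)
    show "distributive_action G X \<alpha> \<longleftrightarrow>
      (\<forall>g\<in>carrier G. \<forall>x\<in>topspace X.
        homeomorphic_map X X (\<alpha> g x) \<and> biequivariant G X \<alpha> X \<alpha> (\<alpha> g x))"
      by (simp add: distributive_action_iff_biequivariant homeomorphic_map_action)
    show "distributive_action G X \<alpha> \<longleftrightarrow>
      (\<forall>g\<in>carrier G. \<forall>h\<in>carrier G. \<forall>x\<in>topspace X. \<forall>y\<in>topspace X.
        \<forall>z\<in>topspace X. (\<alpha> g x \<circ> \<alpha> h y) z = (\<alpha> h (\<alpha> g x y) \<circ> \<alpha> g x) z)"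
      unfolding distributive_action_def o_apply by blast
  qed
qed

end
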